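(* Let $A$ be a finite alphabet and let $\sigma:A\to A^+$ be an aperiodic substitution (with $X_\sigma$ uncountable). Then $\sigma$ is recognizable, i.e. for each $x\in X_\sigma$ there exist a unique $y\in X_\sigma$ and a unique $i\in\{0,\dots,|\sigma(y[0])|-1\}$ such that $x=T_\sigma^i\sigma(y)$.
   Context: $A^+$ is the set of all nonempty words over the finite alphabet $A$; $|w|$ is the length of a word $w$. A substitution is any map $\sigma:A\to A^+$; it is extended to $A^+$ by concatenation, and to $A^{\mathbb Z}$ by concatenation so that in $\sigma(y)$ the word $\sigma(y[0])$ starts at coordinate $0$. The language $L(\sigma)$ is the set of all words occurring as factors of $\sigma^n(a)$, $a\in A$, $n\ge1$. The substitutional dynamical system associated to $\sigma$ is $(X_\sigma,T_\sigma)$ where $X_\sigma=\{x\in A^{\mathbb Z}: x[-n,n]\in L(\sigma)\text{ for all }n\}$ and $T_\sigma$ is the left shift $(T_\sigma x)[n]=x[n+1]$; $x[k]$ is the $k$-th coordinate of $x$. $\sigma$ is aperiodic if $(X_\sigma,T_\sigma)$ has no periodic points. Standing assumption of the paper: $X_\sigma$ is uncountable. *)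

theory Defs
  imports Main "HOL-Library.Sublist" "HOL-Library.Countable_Set"
begin

text \<open>The finite alphabet is a type of class \<open>finite\<close>, words are lists, and two-sided sequences
  are functions on the integers.\<close>

definition is_substitution :: "('a \<Rightarrow> 'a list) \<Rightarrow> bool" where
  "is_substitution \<sigma> \<longleftrightarrow> (\<forall>a. \<sigma> a \<noteq> [])"

definition subst_word :: "('a \<Rightarrow> 'a list) \<Rightarrow> 'a list \<Rightarrow> 'a list" where
  "subst_word \<sigma> w = concat (map \<sigma> w)"

text \<open>The coordinate at which the block \<open>\<sigma> (y k)\<close> starts in \<open>\<sigma>(y)\<close>; the block of \<open>y 0\<close> starts at 0.\<close>

definition block_start :: "('a \<Rightarrow> 'a list) \<Rightarrow> (int \<Rightarrow> 'a) \<Rightarrow> int \<Rightarrow> int" where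
  "block_start \<sigma> y k =
     (if 0 \<le> k then (\<Sum>j\<in>{0..<k}. int (length (\<sigma> (y j))))
      else - (\<Sum>j\<in>{k..<0}. int (length (\<sigma> (y j)))))"

text \<open>For a substitution, the blocks partition the integers, so the description below picks the
  unique block covering the coordinate \<open>n\<close>; see \<open>subst_seq_block\<close>.\<close>

definition subst_seq :: "('a \<Rightarrow> 'a list) \<Rightarrow> (int \<Rightarrow> 'a) \<Rightarrow> (int \<Rightarrow> 'a)" where
  "subst_seq \<sigma> y n =
     (let k = (THE k. block_start \<sigma> y k \<le> n \<and> n < block_start \<sigma> y (k + 1))
      in \<sigma> (y k) ! nat (n - block_start \<sigma> y k))"

definition subst_language :: "('a \<Rightarrow> 'a list) \<Rightarrow> 'a list set" where
  "subst_language \<sigma> = {w. \<exists>a. \<exists>n\<ge>1. sublist w ((subst_word \<sigma> ^^ n) [a])}"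

definition subst_shift :: "('a \<Rightarrow> 'a list) \<Rightarrow> (int \<Rightarrow> 'a) set" where
  "subst_shift \<sigma> = {x. \<forall>n::nat. map x [- int n..int n] \<in> subst_language \<sigma>}"

definition left_shift :: "(int \<Rightarrow> 'a) \<Rightarrow> (int \<Rightarrow> 'a)" where
  "left_shift x = (\<lambda>n. x (n + 1))"

definition aperiodic_subst :: "('a \<Rightarrow> 'a list) \<Rightarrow> bool" where
  "aperiodic_subst \<sigma> \<longleftrightarrow> \<not> (\<exists>x\<in>subst_shift \<sigma>. \<exists>p>0. (left_shift ^^ p) x = x)"

text \<open>Uniqueness is that of the pair \<open>(y, i)\<close>.\<close>

definition recognizable :: "('a \<Rightarrow> 'a list) \<Rightarrow> bool" where
  "recognizable \<sigma> \<longleftrightarrow>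
     (\<forall>x\<in>subst_shift \<sigma>. \<exists>!(y, i).
        y \<in> subst_shift \<sigma> \<and> i < length (\<sigma> (y 0)) \<and> x = (left_shift ^^ i) (subst_seq \<sigma> y))"

lemma block_start_step:
  "block_start \<sigma> y (k + 1) = block_start \<sigma> y k + int (length (\<sigma> (y k)))"
proof (cases "0 \<le> k")
  case True
  then have "{0..<k+1} = insert k {0..<k}" by auto
  then show ?thesis using True by (simp add: block_start_def)
next
  case False
  then have "{k..<0} = insert k {k+1..<0}" by auto
  then show ?thesis using False by (cases "k = -1") (auto simp: block_start_def)
qed

lemma block_start_mono:
  assumes "k \<le> l"
  shows "block_start \<sigma> y k \<le> block_start \<sigma> y l"
  using assms by (induction l rule: int_ge_induct) (auto simp: block_start_step)

lemma subst_seq_block: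
  assumes "i < length (\<sigma> (y k))"
  shows "subst_seq \<sigma> y (block_start \<sigma> y k + int i) = \<sigma> (y k) ! i"
proof -
  let ?n = "block_start \<sigma> y k + int i"
  have "(THE l. block_start \<sigma> y l \<le> ?n \<and> ?n < block_start \<sigma> y (l + 1)) = k"
  proof (rule the_equality)
    show "block_start \<sigma> y k \<le> ?n \<and> ?n < block_start \<sigma> y (k + 1)"
      using assms by (simp add: block_start_step)
  next
    fix l assume l: "block_start \<sigma> y l \<le> ?n \<and> ?n < block_start \<sigma> y (l + 1)"
    have "\<not> l < k"
      using l block_start_mono[of "l + 1" k \<sigma> y] by auto
    moreover have "\<not> k < l"
      using l assms block_start_mono[of "k + 1" l \<sigma> y] by (auto simp: block_start_step)
    ultimately show "l = k" by simp
  qed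
  then show ?thesis by (simp add: subst_seq_def)
qed

end

theory Submission
  imports Defs "HOL-Library.Stream"
begin

text \<open>Existence of a desubstitution is a compactness argument: a long window of \<open>x\<close> lies in some
\<open>\<sigma>(w)\<close> with \<open>w\<close> in the language, so windows of arbitrary length can be desubstituted, and a
cluster point of these finite desubstitutions serves for all of \<open>x\<close> (\<open>desubstitution\<close>).

Uniqueness rests on a defect theorem. Call a finite set \<open>V\<close> of nonempty words elementary if no
smaller set of words generates all of \<open>V\<close>. If two infinite products of words of a set \<open>W\<close> agree
although their first words differ, repeatedly cutting the shorter first word off the longer one
shows that \<open>|W| - 1\<close> words generate \<open>W\<close>; two such coincidences, for different pairs of first words, even
save two words (\<open>two_conflicts_defect\<close>). Hence a factorization over an elementary \<open>V\<close> is determined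
by any one of its cuts. Now let a two-sided sequence \<open>x\<close> have two factorizations over \<open>V\<close> without
common cut, and let \<open>r\<close> be the word between a cut of the first and a later cut of the second. Then
\<open>r\<close> is not in \<open>V\<close>, and \<open>r\<close> followed by words of \<open>V\<close> equals a product over \<open>V\<close>: a coincidence in
\<open>V \<union> {r}\<close>. Two of them, with different first words of the product, would make \<open>|V| - 1\<close> words
sufficient, so \<open>r\<close> alone determines the next word of the first factorization. Iterating in both
directions, \<open>r\<close> determines \<open>x\<close>.
As the overlaps \<open>r\<close> can be chosen of bounded length, one of them occurs twice, and \<open>x\<close> is periodic.
So a sequence that is not periodic has at most one factorization over \<open>V\<close> (\<open>track_unique\<close>).

The substitution itself need not give an elementary set \<open>\<sigma>(A)\<close>. But take, over all \<open>n\<close>, a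
set \<open>Y\<close> of least cardinality that generates all words \<open>\<sigma>\<^sup>n(a)\<close>. Then \<open>\<sigma>(Y)\<close> generates all
words \<open>\<sigma>\<^sup>n\<^sup>+\<^sup>1(a)\<close>, so by minimality \<open>\<sigma>\<close> is injective on \<open>Y\<close> and \<open>\<sigma>(Y)\<close> is elementary
(\<open>elementary_level\<close>). Every point \<open>y\<close> of the shift factors into words \<open>\<sigma>\<^sup>n(a)\<close> by repeated
desubstitution, hence into words of \<open>Y\<close>, and \<open>\<sigma>(y)\<close> factors into words of \<open>\<sigma>(Y)\<close>. If \<open>x\<close> is
represented by both \<open>y\<close> and \<open>y'\<close>, the two factorizations of \<open>x\<close> over \<open>\<sigma>(Y)\<close> coincide because \<open>x\<close>
is not periodic, and injectivity on \<open>Y\<close> recovers \<open>y = y'\<close> together with the position of its blocks.\<close>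

section \<open>Infinite words and the defect effect\<close>

abbreviation star :: "'b list set \<Rightarrow> 'b list set" where
  "star W \<equiv> concat ` lists W"

coinductive_set omega :: "'b list set \<Rightarrow> 'b stream set" for W where
  omega_shift: "w \<in> W \<Longrightarrow> s \<in> omega W \<Longrightarrow> w @- s \<in> omega W"

text \<open>A conflict is a nontrivial relation between infinite products, recorded by its two first words.\<close>

definition conflict :: "'b list set \<Rightarrow> 'b list \<Rightarrow> 'b list \<Rightarrow> bool" where
  "conflict W a b \<longleftrightarrow>
     a \<in> W \<and> b \<in> W \<and> a \<noteq> b \<and> (\<exists>s\<in>omega W. \<exists>t\<in>omega W. a @- s = b @- t)"

lemma star_base: "w \<in> W \<Longrightarrow> w \<in> star W"
  by (rule image_eqI[of _ _ "[w]"]) auto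

lemma star_append: "u \<in> star W \<Longrightarrow> v \<in> star W \<Longrightarrow> u @ v \<in> star W"
proof -
  assume "u \<in> star W" "v \<in> star W"
  then obtain us vs where "us \<in> lists W" "vs \<in> lists W" "u = concat us" "v = concat vs"
    by auto
  then show ?thesis by (intro image_eqI[of _ _ "us @ vs"]) auto
qed

lemma star_concat: "set us \<subseteq> star W \<Longrightarrow> concat us \<in> star W"
proof (induction us)
  case Nil
  show ?case by (rule image_eqI[of _ _ "[]"]) auto
next
  case (Cons u us)
  then have "u \<in> star W" "concat us \<in> star W" by simp_all
  then show ?case using star_append by simp
qed

lemma star_trans:
  assumes "U \<subseteq> star V" "V \<subseteq> star W"
  shows "U \<subseteq> star W"
proof
  fix u assume "u \<in> U"
  then obtain us where "us \<in> lists V" "u = concat us" using assms(1) by auto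
  then show "u \<in> star W" using star_concat[of us W] assms(2) by auto
qed

lemma omega_cases:
  assumes "s \<in> omega W"
  obtains w t where "w \<in> W" "t \<in> omega W" "s = w @- t"
  using assms by (auto elim: omega.cases)

text \<open>The coinduction needs its invariant in the form that part of a word of \<open>W\<close>, already spelled
over \<open>W'\<close>, is still waiting to be consumed.\<close>

lemma omega_star:
  assumes "[] \<notin> W" "W \<subseteq> star W'" "s \<in> omega W"
  shows "s \<in> omega W'"
proof -
  have "\<exists>us t. us \<in> lists W' \<and> s = concat us @- t \<and> t \<in> omega W"
    using assms(3) by (intro exI[of _ "[]"] exI[of _ s]) auto
  then show ?thesis
  proof (coinduction arbitrary: s rule: omega.coinduct)
    case (omega s)
    then obtain us t where us: "us \<in> lists W'" "s = concat us @- t" "t \<in> omega W" by blast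
    obtain v vs t' where *: "v # vs \<in> lists W'" "s = concat (v # vs) @- t'" "t' \<in> omega W"
    proof (cases us)
      case (Cons v vs)
      then show ?thesis using that us by blast
    next
      case Nil
      obtain w t' where w: "w \<in> W" "t' \<in> omega W" "t = w @- t'"
        using us(3) by (rule omega_cases)
      then obtain ws where ws: "ws \<in> lists W'" "w = concat ws" using assms(2) by auto
      with w assms(1) obtain v vs where "ws = v # vs" by (cases ws) auto
      then show ?thesis using that[of v vs t'] ws w us Nil by simp
    qed
    then show ?case
      by (intro exI[of _ v] exI[of _ "concat vs @- t'"]) auto
  qed
qed

lemma omega_mono: "[] \<notin> W \<Longrightarrow> W \<subseteq> W' \<Longrightarrow> s \<in> omega W \<Longrightarrow> s \<in> omega W'"
  using omega_star star_base by (metis subset_iff)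

lemma conflict_sym: "conflict W a b \<Longrightarrow> conflict W b a"
  unfolding conflict_def by metis

lemma shift_eq_prefix:
  assumes "a @- s = b @- t" "length a \<le> length b"
  obtains u where "b = a @ u" "s = u @- t"
proof -
  have "stake (length a) (a @- s) = stake (length a) (b @- t)" using assms(1) by simp
  then have "a = take (length a) b" using assms(2) by (simp add: stake_shift)
  then have b: "b = a @ drop (length a) b" by (metis append_take_drop_id)
  then have "a @- s = a @- drop (length a) b @- t" using assms(1) by (metis shift_append)
  then show ?thesis using that b by simp
qed

text \<open>The descent step behind the defect theorem: a longer first word \<open>b = a t\<close> is replaced by its
remainder \<open>t\<close>. Cancelling \<open>a\<close> turns the given conflict into one between \<open>t\<close> and an old word, while any
other conflict survives with \<open>a\<close> in place of \<open>b\<close>; only the pair \<open>{a, b}\<close> itself would collapse.\<close>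

lemma conflict_reduce:
  assumes fin: "finite W" and ne: "[] \<notin> W" and ab: "conflict W a b"
    and le: "length a \<le> length b"
  obtains t f where
    "t \<noteq> []" "b = a @ t" "f \<in> W - {b}"
    "W \<subseteq> star (insert t (W - {b}))"
    "sum length (insert t (W - {b})) < sum length W"
    "t \<notin> W - {b} \<longrightarrow> conflict (insert t (W - {b})) t f"
    "\<forall>c d. conflict W c d \<longrightarrow> {c, d} \<noteq> {a, b} \<longrightarrow>
       conflict (insert t (W - {b})) (if c = b then a else c) (if d = b then a else d)"
proof -
  obtain s s' where s: "a \<in> W" "b \<in> W" "a \<noteq> b" "s \<in> omega W" "s' \<in> omega W" "a @- s = b @- s'"
    using ab unfolding conflict_def by auto
  obtain t where t: "b = a @ t" "s = t @- s'" using shift_eq_prefix[OF s(6) le] .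
  have tn: "t \<noteq> []" using t s(3) by auto
  have an: "a \<noteq> []" using s(1) ne by auto
  define W' where "W' = insert t (W - {b})"
  \<comment> \<open>The first word, over the new set, of a product that starts with \<open>c\<close> over the old set.\<close>
  define h where "h = (\<lambda>c. if c = b then a else c)"
  have ne': "[] \<notin> W'" using ne tn unfolding W'_def by auto
  have sub: "W \<subseteq> star W'"
  proof
    fix w assume "w \<in> W"
    then show "w \<in> star W'"
      using star_append[OF star_base star_base, of a W' t] s t star_base[of w W']
      unfolding W'_def by (cases "w = b") auto
  qed
  have hW: "h c \<in> W - {b}" if "c \<in> W" for c using that s(1,3) unfolding h_def by auto
  have om: "x \<in> omega W'" if "x \<in> omega W" for x using omega_star[OF ne sub that] .
  have head: "\<exists>y\<in>omega W'. c @- x = h c @- y" if "x \<in> omega W" for c x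
    using that om[OF that] omega_shift[of t W' x] t(1) unfolding h_def W'_def by auto
  have "sum length W = length b + sum length (W - {b})"
    using fin s(2) by (simp add: sum.remove)
  moreover have "sum length W' \<le> length t + sum length (W - {b})"
    using fin unfolding W'_def by (simp add: sum.insert_if)
  moreover have "length t < length b" using t(1) an by simp
  ultimately have less: "sum length W' < sum length W" by linarith
  obtain w r where w: "w \<in> W" "r \<in> omega W" "s = w @- r" using s(4) by (rule omega_cases)
  have f: "h w \<in> W - {b}" using hW w by auto
  have c1: "conflict W' t (h w)" if "t \<notin> W - {b}"
  proof -
    obtain y where "y \<in> omega W'" "w @- r = h w @- y" using head w by blast
    then have "t @- s' = h w @- y" using t w by simp
    moreover have "t \<noteq> h w" using that f by metis
    ultimately show ?thesis using om[OF s(5)] \<open>y \<in> omega W'\<close> f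
      unfolding conflict_def W'_def by auto
  qed
  have c2: "conflict W' (h c) (h d)" if cd: "conflict W c d" and "{c, d} \<noteq> {a, b}" for c d
  proof -
    obtain x x' where x: "c \<in> W" "d \<in> W" "c \<noteq> d" "x \<in> omega W" "x' \<in> omega W" "c @- x = d @- x'"
      using cd unfolding conflict_def by auto
    have "h c \<noteq> h d" using x(3) that(2) unfolding h_def by auto
    moreover have "\<exists>y\<in>omega W'. \<exists>y'\<in>omega W'. h c @- y = h d @- y'"
      using head[OF x(4), of c] head[OF x(5), of d] x(6) by metis
    ultimately show ?thesis using hW[OF x(1)] hW[OF x(2)] unfolding conflict_def W'_def by auto
  qed
  show ?thesis
    using that[OF tn t(1) f] sub less c1 c2 unfolding W'_def h_def by blast
qed

text \<open>As long as the remainder \<open>t\<close> is a new word, the reduced set has as many elements and again a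
conflict, so the descent on total length continues; it ends when \<open>t\<close> is already present and a word
has been saved.\<close>

lemma conflict_defect:
  assumes "finite W" "[] \<notin> W" "conflict W a b"
  shows "\<exists>Z. finite Z \<and> [] \<notin> Z \<and> W \<subseteq> star Z \<and> card Z + 1 \<le> card W"
  using assms
proof (induction "sum length W" arbitrary: W a b rule: less_induct)
  case less
  have "\<exists>a b. conflict W a b \<and> length a \<le> length b"
    using less.prems(3) conflict_sym by (metis nat_le_linear)
  then obtain a b where ab: "conflict W a b" "length a \<le> length b" by blast
  obtain t f where t: "t \<noteq> []" "b = a @ t" "f \<in> W - {b}" "W \<subseteq> star (insert t (W - {b}))"
    "sum length (insert t (W - {b})) < sum length W"
    "t \<notin> W - {b} \<longrightarrow> conflict (insert t (W - {b})) t f"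
    "\<forall>c d. conflict W c d \<longrightarrow> {c, d} \<noteq> {a, b} \<longrightarrow>
       conflict (insert t (W - {b})) (if c = b then a else c) (if d = b then a else d)"
    using conflict_reduce[OF less.prems(1,2) ab] .
  let ?W = "insert t (W - {b})"
  have bW: "b \<in> W" using ab unfolding conflict_def by auto
  have fin: "finite ?W" "[] \<notin> ?W" using less.prems t by auto
  have cW: "card (W - {b}) + 1 = card W" using card_Suc_Diff1[OF less.prems(1) bW] by simp
  show ?case
  proof (cases "t \<in> W - {b}")
    case True
    then have "?W = W - {b}" by auto
    then show ?thesis using fin t(4) cW by (intro exI[of _ ?W]) auto
  next
    case False
    then have "card ?W = card W" using less.prems(1) cW by simp
    then show ?thesis using less.hyps[OF t(5) fin t(6)[rule_format, OF False]] star_trans[OF t(4)] by auto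
  qed
qed

text \<open>The same descent carries two conflicts along. They stay distinct: the reduced first one involves
the new word \<open>t\<close>, the second one does not. When a word is saved, the second conflict is still there
to save another.\<close>

lemma two_conflicts_defect:
  assumes "finite W" "[] \<notin> W" "conflict W a b" "conflict W c d" "{a, b} \<noteq> {c, d}"
  shows "\<exists>Z. finite Z \<and> [] \<notin> Z \<and> W \<subseteq> star Z \<and> card Z + 2 \<le> card W"
  using assms
proof (induction "sum length W" arbitrary: W a b c d rule: less_induct)
  case less
  obtain a b where ab: "conflict W a b" "length a \<le> length b" and neq: "{c, d} \<noteq> {a, b}"
  proof (cases "length a \<le> length b")
    case True
    then show ?thesis using that[of a b] less.prems(3,5) by simp
  next
    case False
    have "{b, a} = {a, b}" by auto
    then have "{c, d} \<noteq> {b, a}" using less.prems(5) by metis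
    then show ?thesis using that[of b a] False conflict_sym[OF less.prems(3)] by simp
  qed
  obtain t f where t: "t \<noteq> []" "b = a @ t" "f \<in> W - {b}" "W \<subseteq> star (insert t (W - {b}))"
    "sum length (insert t (W - {b})) < sum length W"
    "t \<notin> W - {b} \<longrightarrow> conflict (insert t (W - {b})) t f"
    "\<forall>c d. conflict W c d \<longrightarrow> {c, d} \<noteq> {a, b} \<longrightarrow>
       conflict (insert t (W - {b})) (if c = b then a else c) (if d = b then a else d)"
    using conflict_reduce[OF less.prems(1,2) ab] .
  let ?W = "insert t (W - {b})"
  obtain c' d' where h: "c' = (if c = b then a else c)" "d' = (if d = b then a else d)" by blast
  have bW: "a \<in> W - {b}" "b \<in> W" "c \<in> W" "d \<in> W"
    using ab less.prems(4) unfolding conflict_def by auto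
  have fin: "finite ?W" "[] \<notin> ?W" using less.prems t by auto
  have cW: "card (W - {b}) + 1 = card W" using card_Suc_Diff1[OF less.prems(1) bW(2)] by simp
  have cd: "conflict ?W c' d'" using t(7) less.prems(4) neq unfolding h by blast
  show ?case
  proof (cases "t \<in> W - {b}")
    case True
    then have "card ?W + 1 = card W" using cW by (simp add: insert_absorb)
    moreover obtain Z where "finite Z" "[] \<notin> Z" "?W \<subseteq> star Z" "card Z + 1 \<le> card ?W"
      using conflict_defect[OF fin cd] by blast
    ultimately show ?thesis using star_trans[OF t(4)] by (intro exI[of _ Z]) simp
  next
    case False
    then have "card ?W = card W" using less.prems(1) cW by simp
    moreover have "c' \<noteq> t" "d' \<noteq> t" using False bW unfolding h by auto
    then have "{t, f} \<noteq> {c', d'}" by (metis doubleton_eq_iff)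
    then obtain Z where "finite Z" "[] \<notin> Z" "?W \<subseteq> star Z" "card Z + 2 \<le> card ?W"
      using less.hyps[OF t(5) fin t(6)[rule_format, OF False] cd] by blast
    ultimately show ?thesis using star_trans[OF t(4)] by (intro exI[of _ Z]) simp
  qed
qed

definition elementary :: "'b list set \<Rightarrow> bool" where
  "elementary V \<longleftrightarrow> finite V \<and> [] \<notin> V \<and>
     (\<forall>Z. finite Z \<longrightarrow> [] \<notin> Z \<longrightarrow> V \<subseteq> star Z \<longrightarrow> card V \<le> card Z)"

lemma elementary_unique_first:
  assumes "elementary V" "u \<in> V" "v \<in> V" "s \<in> omega V" "t \<in> omega V" "u @- s = v @- t"
  shows "u = v"
proof (rule ccontr)
  assume "u \<noteq> v"
  then have "conflict V u v" using assms unfolding conflict_def by blast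
  then obtain Z where "finite Z" "[] \<notin> Z" "V \<subseteq> star Z" "card Z + 1 \<le> card V"
    using conflict_defect assms(1) unfolding elementary_def by metis
  then show False using assms(1) unfolding elementary_def by fastforce
qed

text \<open>This is where two conflicts are needed: adjoining \<open>r\<close> adds one word, so a single conflict
would not contradict that \<open>V\<close> is elementary.\<close>

lemma elementary_unique_after:
  assumes V: "elementary V" and r: "r \<notin> V" "r \<noteq> []" and uv: "u \<in> V" "v \<in> V"
    and om: "s \<in> omega V" "s' \<in> omega V" "t \<in> omega V" "t' \<in> omega V"
    and eq: "r @- s = u @- s'" "r @- t = v @- t'"
  shows "u = v"
proof (rule ccontr)
  assume "u \<noteq> v"
  have V': "finite V" "[] \<notin> V" using V unfolding elementary_def by auto
  note om' = omega_mono[OF V'(2) subset_insertI[of V r]]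
  have "conflict (insert r V) r u" "conflict (insert r V) r v"
    using om[THEN om'] r uv eq unfolding conflict_def by blast+
  moreover have "{r, u} \<noteq> {r, v}" using \<open>u \<noteq> v\<close> by (auto simp: doubleton_eq_iff)
  ultimately obtain Z where
    Z: "finite Z" "[] \<notin> Z" "insert r V \<subseteq> star Z" "card Z + 2 \<le> card (insert r V)"
    using two_conflicts_defect[of "insert r V" r u r v] V' r by auto
  then have "card V \<le> card Z" using V unfolding elementary_def by auto
  then show False using Z(4) V'(1) r(1) by simp
qed

lemma star_rev_subset: "rev ` star Z \<subseteq> star (rev ` Z)"
proof (rule image_subsetI)
  fix w assume "w \<in> star Z"
  then obtain us where us: "us \<in> lists Z" "w = concat us" by blast
  have "rev w = concat (rev (map rev us))" using us(2) by (simp add: rev_concat rev_map)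
  moreover have "rev (map rev us) \<in> lists (rev ` Z)" using us(1) by auto
  ultimately show "rev w \<in> star (rev ` Z)" by blast
qed

lemma elementary_rev:
  assumes "elementary V"
  shows "elementary (rev ` V)"
  unfolding elementary_def
proof (intro conjI allI impI)
  show "finite (rev ` V)" "[] \<notin> rev ` V" using assms unfolding elementary_def by auto
  fix Z :: "'a list set"
  assume Z: "finite Z" "[] \<notin> Z" "rev ` V \<subseteq> star Z"
  have "rev ` rev ` V \<subseteq> rev ` star Z" using Z(3) by (rule image_mono)
  then have "V \<subseteq> star (rev ` Z)" using star_rev_subset[of Z] by (simp add: image_comp subset_trans)
  moreover have "finite (rev ` Z)" "[] \<notin> rev ` Z" using Z by auto
  ultimately have "card V \<le> card (rev ` Z)" using assms unfolding elementary_def by blast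
  then show "card (rev ` V) \<le> card Z" by (simp add: card_image inj_on_def)
qed

section \<open>Factorizations of two-sided sequences\<close>

primcorec ray :: "(int \<Rightarrow> 'b) \<Rightarrow> int \<Rightarrow> 'b stream" where
  "shd (ray x p) = x p"
| "stl (ray x p) = ray x (p + 1)"

definition occurs :: "(int \<Rightarrow> 'b) \<Rightarrow> int \<Rightarrow> 'b list \<Rightarrow> bool" where
  "occurs x p w \<longleftrightarrow> (\<forall>i<length w. x (p + int i) = w ! i)"

text \<open>A factorization of \<open>x\<close> over \<open>V\<close> is encoded by its set of cuts, closed under moving on and moving
back by a word of \<open>V\<close>. A track may a priori contain several interleaved factorizations; with this
freedom differences, images and refinements of tracks are tracks without any renumbering of cuts.\<close>

definition track :: "'b list set \<Rightarrow> (int \<Rightarrow> 'b) \<Rightarrow> int set \<Rightarrow> bool" where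
  "track V x P \<longleftrightarrow> (\<forall>p\<in>P.
     (\<exists>v\<in>V. occurs x p v \<and> p + int (length v) \<in> P) \<and>
     (\<exists>v\<in>V. occurs x (p - int (length v)) v \<and> p - int (length v) \<in> P))"

text \<open>The reflection about \<open>-1/2\<close>, so that a cut (to the left of coordinate \<open>p\<close>) becomes the cut at \<open>-p\<close>.\<close>

definition mirror :: "(int \<Rightarrow> 'b) \<Rightarrow> int \<Rightarrow> 'b" where
  "mirror x = (\<lambda>n. x (- 1 - n))"

lemma occurs_Nil [simp]: "occurs x p []"
  by (simp add: occurs_def)

lemma occurs_Cons: "occurs x p (a # w) \<longleftrightarrow> x p = a \<and> occurs x (p + 1) w"
  unfolding occurs_def by (auto simp: nth_Cons less_Suc_eq_0_disj add.assoc)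

lemma occurs_append:
  "occurs x p (u @ v) \<longleftrightarrow> occurs x p u \<and> occurs x (p + int (length u)) v"
  by (induction u arbitrary: p) (auto simp: occurs_Cons add.assoc)

lemma ray_occurs: "occurs x p w \<Longrightarrow> ray x p = w @- ray x (p + int (length w))"
proof (induction w arbitrary: p)
  case (Cons a w)
  then have "ray x (p + 1) = w @- ray x (p + 1 + int (length w))" "x p = a"
    by (auto simp: occurs_Cons)
  then show ?case by (subst ray.code) (simp add: add.assoc)
qed simp

lemma occurs_mirror:
  assumes "occurs x p w"
  shows "occurs (mirror x) (- (p + int (length w))) (rev w)"
  unfolding occurs_def
proof (intro allI impI)
  fix i assume i: "i < length (rev w)"
  have "- 1 - (- (p + int (length w)) + int i) = p + int (length w - Suc i)"
    using i by (simp add: of_nat_diff)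
  then have "mirror x (- (p + int (length w)) + int i) = x (p + int (length w - Suc i))"
    unfolding mirror_def by (rule arg_cong)
  also have "\<dots> = w ! (length w - Suc i)" using assms i unfolding occurs_def by (simp del: of_nat_diff of_nat_Suc)
  finally show "mirror x (- (p + int (length w)) + int i) = rev w ! i" using i by (simp add: rev_nth)
qed

lemma trackE_next:
  assumes "track V x P" "p \<in> P"
  obtains v where "v \<in> V" "occurs x p v" "p + int (length v) \<in> P"
  using assms unfolding track_def by blast

lemma trackE_prev:
  assumes "track V x P" "p \<in> P"
  obtains v where "v \<in> V" "occurs x (p - int (length v)) v" "p - int (length v) \<in> P"
  using assms unfolding track_def by blast

lemma track_mirror:
  assumes "track V x P"
  shows "track (rev ` V) (mirror x) (uminus ` P)"
  unfolding track_def
proof (intro ballI conjI)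
  fix q assume "q \<in> uminus ` P"
  then obtain p where p: "p \<in> P" "q = - p" by auto
  obtain v where v: "v \<in> V" "occurs x (p - int (length v)) v" "p - int (length v) \<in> P"
    using trackE_prev[OF assms p(1)] .
  show "\<exists>v\<in>rev ` V. occurs (mirror x) q v \<and> q + int (length v) \<in> uminus ` P"
    using occurs_mirror[OF v(2)] v(1) p imageI[OF v(3), of uminus]
    by (intro bexI[of _ "rev v"]) simp_all
  obtain w where w: "w \<in> V" "occurs x p w" "p + int (length w) \<in> P"
    using trackE_next[OF assms p(1)] .
  show "\<exists>v\<in>rev ` V. occurs (mirror x) (q - int (length v)) v \<and> q - int (length v) \<in> uminus ` P"
    using occurs_mirror[OF w(2)] w(1) p imageI[OF w(3), of uminus]
    by (intro bexI[of _ "rev w"]) simp_all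
qed

lemma track_ray_omega:
  assumes "track V x P" "p \<in> P"
  shows "ray x p \<in> omega V"
proof -
  from assms(2) show ?thesis
  proof (coinduction arbitrary: p rule: omega.coinduct)
    case (omega p)
    obtain v where v: "v \<in> V" "occurs x p v" "p + int (length v) \<in> P"
      using trackE_next[OF assms(1) omega] .
    show ?case using v ray_occurs[OF v(2)] by blast
  qed
qed

lemma track_unbounded_below:
  assumes "track V x P" "[] \<notin> V" "p \<in> P"
  shows "\<exists>q\<in>P. q \<le> p - int n"
proof (induction n)
  case 0
  then show ?case using assms by auto
next
  case (Suc n)
  then obtain q where q: "q \<in> P" "q \<le> p - int n" by blast
  obtain v where v: "v \<in> V" "q - int (length v) \<in> P"
    using trackE_prev[OF assms(1) q(1)] .
  have "int (length v) \<ge> 1" using v assms(2) by (cases v) auto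
  then show ?case using q v by (intro bexI[of _ "q - int (length v)"]) linarith+
qed

lemma track_covers:
  assumes "track V x P" "[] \<notin> V" "P \<noteq> {}"
  obtains p v where "p \<in> P" "v \<in> V" "occurs x p v" "p + int (length v) \<in> P"
    "p \<le> j" "j < p + int (length v)"
proof -
  obtain p0 where "p0 \<in> P" using assms(3) by auto
  then obtain q where "q \<in> P" "q \<le> p0 - int (nat (p0 - j))"
    using track_unbounded_below[OF assms(1,2)] by blast
  then have "q \<in> P \<and> q \<le> j" by linarith
  \<comment> \<open>The last cut not beyond \<open>j\<close>.\<close>
  then obtain p where p: "p \<in> P" "p \<le> j"
    and max: "\<And>q. q \<in> P \<and> q \<le> j \<Longrightarrow> nat (j - p) \<le> nat (j - q)"
    using ex_has_least_nat[of "\<lambda>q. q \<in> P \<and> q \<le> j" _ "\<lambda>q. nat (j - q)"] by metis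
  obtain v where v: "v \<in> V" "occurs x p v" "p + int (length v) \<in> P"
    using trackE_next[OF assms(1) p(1)] .
  have "int (length v) \<ge> 1" using v assms(2) by (cases v) auto
  then have "j < p + int (length v)" using max[of "p + int (length v)"] v(3) p(2) by linarith
  then show ?thesis using that p v by blast
qed

lemma next_block_unique:
  assumes V: "elementary V" "track V x P" "track V x Q"
    and u: "u \<in> V" "occurs x p u" "p + int (length u) \<in> P"
    and v: "v \<in> V" "occurs x p v" "p + int (length v) \<in> Q"
  shows "u = v"
  using elementary_unique_first[OF V(1) u(1) v(1) track_ray_omega[OF V(2) u(3)]
      track_ray_omega[OF V(3) v(3)]] ray_occurs[OF u(2)] ray_occurs[OF v(2)]
  by simp

lemma previous_block_unique:
  assumes V: "elementary V" "track V x P" "track V x Q"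
    and u: "u \<in> V" "occurs x (p - int (length u)) u" "p - int (length u) \<in> P"
    and v: "v \<in> V" "occurs x (p - int (length v)) v" "p - int (length v) \<in> Q"
  shows "u = v"
proof -
  have "rev u = rev v"
  proof (rule next_block_unique[OF elementary_rev[OF V(1)] track_mirror[OF V(2)]
        track_mirror[OF V(3)], where p = "- p"])
    show "occurs (mirror x) (- p) (rev u)" "occurs (mirror x) (- p) (rev v)"
      using occurs_mirror[OF u(2)] occurs_mirror[OF v(2)] by simp_all
    have "- p + int (length (rev u)) = - (p - int (length u))"
      "- p + int (length (rev v)) = - (p - int (length v))" by simp_all
    then show "- p + int (length (rev u)) \<in> uminus ` P" "- p + int (length (rev v)) \<in> uminus ` Q"
      using u(3) v(3) by (metis imageI)+
  qed (use u v in auto)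
  then show ?thesis by simp
qed

text \<open>Let the same overlap \<open>r\<close>, from a cut of \<open>P\<close> to a later cut of \<open>Q\<close>, be seen at \<open>p\<close> and at
\<open>p + D\<close>. Then the blocks of \<open>P\<close> starting there agree, and beyond such a block one has again a common
overlap, between the same two tracks in one order or the other. Each round shifts the left end of the
overlap by at least one, whence the induction on the length of the agreement.\<close>

lemma overlap_determines_right:
  assumes "elementary V"
    and "track V x P" "track V x Q" "P \<inter> Q = {}"
    and "p \<in> P" "p + D \<in> P" "q \<in> Q" "q + D \<in> Q" "p < q"
    and "\<And>j. p \<le> j \<Longrightarrow> j < q \<Longrightarrow> x (j + D) = x j"
    and "p \<le> j" "j < p + int n"
  shows "x (j + D) = x j"
  using assms
proof (induction n arbitrary: P Q p q j)
  case 0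
  then show ?case by simp
next
  case (Suc n)
  note V = Suc.prems(1) and P = Suc.prems(2) and Q = Suc.prems(3)
  obtain u where u: "u \<in> V" "occurs x p u" "p + int (length u) \<in> P"
    using trackE_next[OF P Suc.prems(5)] .
  obtain v where v: "v \<in> V" "occurs x (p + D) v" "p + D + int (length v) \<in> P"
    using trackE_next[OF P Suc.prems(6)] .
  define r where "r = map x [p..q - 1]"
  have len: "int (length r) = q - p" using \<open>p < q\<close> unfolding r_def by simp
  have r1: "occurs x p r"
    unfolding occurs_def r_def by simp
  have r2: "occurs x (p + D) r"
    unfolding occurs_def
  proof (intro allI impI)
    fix i assume i: "i < length r"
    then have "x (p + int i + D) = x (p + int i)" using Suc.prems(10)[of "p + int i"] len by simp
    also have "\<dots> = r ! i" using r1 i unfolding occurs_def by simp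
    finally show "x (p + D + int i) = r ! i" by (simp add: algebra_simps)
  qed
  have e1: "r @- ray x q = u @- ray x (p + int (length u))"
    using ray_occurs[OF r1] ray_occurs[OF u(2)] len by simp
  have e2: "r @- ray x (q + D) = v @- ray x (p + D + int (length v))"
    using ray_occurs[OF r2] ray_occurs[OF v(2)] len by (simp add: algebra_simps)
  note om = track_ray_omega[OF Q Suc.prems(7)] track_ray_omega[OF P u(3)]
    track_ray_omega[OF Q Suc.prems(8)] track_ray_omega[OF P v(3)]
  have pos: "int (length u) \<ge> 1" using u V unfolding elementary_def by (cases u) auto
  have neq: "p + int (length u) \<noteq> q" using u(3) Suc.prems(4,7) by auto
  \<comment> \<open>Otherwise \<open>r\<close> would be the block of \<open>P\<close> at \<open>p\<close>, and \<open>q\<close> a common cut.\<close>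
  have "r \<notin> V"
  proof
    assume "r \<in> V"
    then have "r = u" using elementary_unique_first[OF V _ u(1) om(1,2) e1] by simp
    then show False using neq len by simp
  qed
  moreover have "r \<noteq> []" using len \<open>p < q\<close> by auto
  ultimately have "u = v"
    using elementary_unique_after[OF V _ _ u(1) v(1) om e1 e2] by simp
  have agree: "x (k + D) = x k" if "p \<le> k" "k < p + int (length u)" for k
  proof -
    define i where "i = nat (k - p)"
    have i: "i < length u" "k = p + int i" using that unfolding i_def by auto
    have "x (p + D + int i) = x (p + int i)"
      using u(2) v(2) i(1) unfolding \<open>u = v\<close> occurs_def by simp
    then show ?thesis using i(2) by (simp add: algebra_simps)
  qed
  let ?p = "p + int (length u)"
  have uD: "?p + D \<in> P" using v(3) \<open>u = v\<close> by (simp add: algebra_simps)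
  show ?case
  proof (cases "?p < q")
    case True
    show ?thesis
    proof (cases "j < ?p")
      case False
      show ?thesis
      proof (rule Suc.IH[OF V P Q Suc.prems(4) u(3) uD Suc.prems(7,8) True])
        show "x (k + D) = x k" if "?p \<le> k" "k < q" for k using Suc.prems(10) that pos by simp
        show "?p \<le> j" "j < ?p + int n" using False Suc.prems(12) pos by linarith+
      qed
    qed (use agree Suc.prems(11) in simp)
  next
    case False
    show ?thesis
    proof (cases "j < q")
      case False
      show ?thesis
      proof (rule Suc.IH[OF V Q P _ Suc.prems(7,8) u(3) uD])
        show "Q \<inter> P = {}" using Suc.prems(4) by blast
        show "q < ?p" using neq \<open>\<not> ?p < q\<close> by simp
        show "x (k + D) = x k" if "q \<le> k" "k < ?p" for k using agree that Suc.prems(9) by simp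
        show "q \<le> j" "j < q + int n" using False Suc.prems(9,12) by simp_all
      qed
    qed (use Suc.prems(10,11) in simp)
  qed
qed

text \<open>Overlaps no longer than the longest word of \<open>V\<close> start at every cut of \<open>P\<close>, so one of them occurs at
two different places. It determines the sequence to its right and, by reflection, to its left;
hence the translation between the two places fixes \<open>x\<close>.\<close>

lemma disjoint_tracks_periodic:
  fixes x :: "int \<Rightarrow> 'b::finite"
  assumes V: "elementary V" and P: "track V x P" "P \<noteq> {}" and Q: "track V x Q" "Q \<noteq> {}"
    and disj: "P \<inter> Q = {}"
  obtains D where "D > 0" "\<And>j. x (j + D) = x j"
proof -
  have V': "finite V" "[] \<notin> V" using V unfolding elementary_def by auto
  define K where "K = Max (length ` V)"
  have K: "length v \<le> K" if "v \<in> V" for v unfolding K_def using V' that by simp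
  have "\<exists>q\<in>Q. p < q \<and> q \<le> p + int K" for p
  proof -
    obtain q v where "v \<in> V" "q + int (length v) \<in> Q" "q \<le> p" "p < q + int (length v)"
      using track_covers[OF Q(1) V'(2) Q(2), of p] by metis
    then show ?thesis using K[of v] by (intro bexI[of _ "q + int (length v)"]) auto
  qed
  then obtain q where q: "\<And>p. q p \<in> Q" "\<And>p. p < q p" "\<And>p. q p \<le> p + int K" by metis
  define r where "r = (\<lambda>p. map x [p..q p - 1])"
  have "r ` P \<subseteq> {w. set w \<subseteq> UNIV \<and> length w \<le> K}"
  proof (rule image_subsetI)
    fix p
    show "r p \<in> {w. set w \<subseteq> UNIV \<and> length w \<le> K}"
      using q(2,3)[of p] unfolding r_def by (simp add: nat_le_iff)
  qed
  then have "finite (r ` P)" using finite_lists_length_le[OF finite_UNIV] by (rule finite_subset)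
  moreover have "infinite P"
  proof
    assume "finite P"
    obtain p where "p \<in> P" "p \<le> Min P - 1"
      using track_unbounded_below[OF P(1) V'(2), of "Min P" 1] P(2) \<open>finite P\<close> by auto
    then show False using Min_le[OF \<open>finite P\<close>] by force
  qed
  ultimately have "\<not> inj_on r P" using finite_image_iff by blast
  then obtain p1 p2 where p: "p1 \<in> P" "p2 \<in> P" "r p1 = r p2" "p1 < p2"
    unfolding inj_on_def by (metis linorder_neqE)
  define D where "D = p2 - p1"
  have len: "q p2 - p2 = q p1 - p1"
    using arg_cong[OF p(3), of length] q(2)[of p1] q(2)[of p2] unfolding r_def by simp
  then have qD: "q p1 + D = q p2" unfolding D_def by simp
  have pD: "p1 + D = p2" unfolding D_def by simp
  have agree: "x (j + D) = x j" if "p1 \<le> j" "j < q p1" for j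
  proof -
    define i where "i = nat (j - p1)"
    have i: "i < length (r p1)" "i < length (r p2)" "j = p1 + int i"
      using that len unfolding i_def r_def by auto
    have "r p1 ! i = x j" "r p2 ! i = x (j + D)"
      using i unfolding r_def D_def by (simp_all add: add.commute)
    then show ?thesis using p(3) by simp
  qed
  have right: "x (j + D) = x j" if "p1 \<le> j" for j
    using overlap_determines_right[OF V P(1) Q(1) disj p(1) _ q(1)[of p1], of D j "nat (j - p1 + 1)"]
      pD qD p(2) q(1)[of p2] q(2)[of p1] agree that by simp
  have left: "x (j + D) = x j" if "j < q p1" for j
  proof -
    \<comment> \<open>In the mirror image the overlap starts at a cut of \<open>Q\<close> and ends at one of \<open>P\<close>.\<close>
    have "mirror x ((- 1 - j - D) + D) = mirror x (- 1 - j - D)"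
    proof (rule overlap_determines_right[OF elementary_rev[OF V] track_mirror[OF Q(1)]
          track_mirror[OF P(1)], where p = "- q p2" and q = "- p2" and n = "nat (q p1 - j)"])
      show "uminus ` Q \<inter> uminus ` P = {}" using disj by auto
      show "- q p2 \<in> uminus ` Q" "- p2 \<in> uminus ` P" using q(1) p(2) by auto
      have "- q p2 + D = - q p1" "- p2 + D = - p1" using pD qD by auto
      then show "- q p2 + D \<in> uminus ` Q" "- p2 + D \<in> uminus ` P" using q(1) p(1) by auto
      show "- q p2 < - p2" using q(2) by simp
      show "mirror x (k + D) = mirror x k" if "- q p2 \<le> k" "k < - p2" for k
        using agree[of "- 1 - k - D"] that qD pD unfolding mirror_def by (simp add: algebra_simps)
      show "- q p2 \<le> - 1 - j - D" "- 1 - j - D < - q p2 + int (nat (q p1 - j))"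
        using qD that by simp_all
    qed
    then show ?thesis unfolding mirror_def by (simp add: algebra_simps)
  qed
  have "x (j + D) = x j" for j using left[of j] right[of j] q(2)[of p1] by fastforce
  then show ?thesis using that[of D] p(4) unfolding D_def by simp
qed

text \<open>Blocks next to a common cut are common to both tracks, so no block leads from a cut outside \<open>Q\<close>
to a cut of \<open>Q\<close> or back.\<close>

lemma track_Diff:
  assumes V: "elementary V" and P: "track V x P" and Q: "track V x Q"
  shows "track V x (P - Q)"
  unfolding track_def
proof (intro ballI conjI)
  fix p assume p: "p \<in> P - Q"
  obtain v where v: "v \<in> V" "occurs x p v" "p + int (length v) \<in> P"
    using trackE_next[OF P, of p] p by blast
  have "p + int (length v) \<notin> Q"
  proof
    assume "p + int (length v) \<in> Q"
    then obtain u where u: "u \<in> V" "occurs x (p + int (length v) - int (length u)) u"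
      "p + int (length v) - int (length u) \<in> Q"
      using trackE_prev[OF Q] by blast
    have "v = u" using previous_block_unique[OF V P Q v(1) _ _ u] v p by simp
    then show False using u p by simp
  qed
  then show "\<exists>v\<in>V. occurs x p v \<and> p + int (length v) \<in> P - Q" using v by blast
  obtain w where w: "w \<in> V" "occurs x (p - int (length w)) w" "p - int (length w) \<in> P"
    using trackE_prev[OF P, of p] p by blast
  have "p - int (length w) \<notin> Q"
  proof
    assume "p - int (length w) \<in> Q"
    then obtain u where u: "u \<in> V" "occurs x (p - int (length w)) u"
      "p - int (length w) + int (length u) \<in> Q"
      using trackE_next[OF Q] by blast
    have "w = u" using next_block_unique[OF V P Q w(1,2) _ u] p by simp
    then show False using u p by simp
  qed
  then show "\<exists>v\<in>V. occurs x (p - int (length v)) v \<and> p - int (length v) \<in> P - Q" using w by blast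
qed

lemma track_unique:
  fixes x :: "int \<Rightarrow> 'b::finite"
  assumes V: "elementary V" and P: "track V x P" "P \<noteq> {}" and Q: "track V x Q" "Q \<noteq> {}"
    and aper: "\<not> (\<exists>D>0. \<forall>j. x (j + D) = x j)"
  shows "P = Q"
proof -
  have "P - Q = {}" if "track V x P" "track V x Q" "Q \<noteq> {}" for P Q
    using disjoint_tracks_periodic[OF V track_Diff[OF V that(1,2)] _ that(2,3)] aper by blast
  then show ?thesis using P Q by blast
qed

section \<open>Blocks of a substitution\<close>

lemma left_shift_funpow: "(left_shift ^^ i) x = (\<lambda>n. x (n + int i))"
  by (induction i arbitrary: x) (auto simp: left_shift_def funpow_swap1 ac_simps)

lemma block_start_0 [simp]: "block_start \<sigma> y 0 = 0"
  by (simp add: block_start_def)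

lemma block_start_ge:
  assumes "is_substitution \<sigma>" "k \<le> l"
  shows "block_start \<sigma> y k + (l - k) \<le> block_start \<sigma> y l"
  using assms(2)
proof (induction l rule: int_ge_induct)
  case (step l)
  have "length (\<sigma> (y l)) > 0" using assms(1) unfolding is_substitution_def by simp
  then have "int (length (\<sigma> (y l))) \<ge> 1" by linarith
  then show ?case using step unfolding block_start_step by linarith
qed simp

lemma block_start_le:
  assumes "\<And>a. int (length (\<sigma> a)) \<le> K" "k \<le> l"
  shows "block_start \<sigma> y l \<le> block_start \<sigma> y k + (l - k) * K"
  using assms(2)
proof (induction l rule: int_ge_induct)
  case (step l)
  have "(l + 1 - k) * K = (l - k) * K + K" by (simp add: algebra_simps)
  then show ?case using step assms(1)[of "y l"] unfolding block_start_step by linarith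
qed simp

lemma block_exists:
  assumes "is_substitution \<sigma>"
  obtains k where "block_start \<sigma> y k \<le> n" "n < block_start \<sigma> y (k + 1)"
proof -
  note ge = block_start_ge[OF assms, where y = y]
  \<comment> \<open>Moving \<open>n\<close> by one keeps the block or passes to an adjacent one, as blocks are nonempty.\<close>
  have "\<exists>k. block_start \<sigma> y k \<le> n \<and> n < block_start \<sigma> y (k + 1)"
  proof (induction n rule: int_induct[where k = 0])
    case base
    show ?case using ge[of 0 1] by (intro exI[of _ 0]) simp
  next
    case (step1 n)
    then obtain k where k: "block_start \<sigma> y k \<le> n" "n < block_start \<sigma> y (k + 1)" by blast
    then show ?case using ge[of "k + 1" "k + 1 + 1"]
      by (cases "n + 1 < block_start \<sigma> y (k + 1)")
        (force intro: exI[of _ k], force intro: exI[of _ "k + 1"])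
  next
    case (step2 n)
    then obtain k where k: "block_start \<sigma> y k \<le> n" "n < block_start \<sigma> y (k + 1)" by blast
    then show ?case using ge[of "k - 1" k]
      by (cases "block_start \<sigma> y k \<le> n - 1")
        (force intro: exI[of _ k], force intro: exI[of _ "k - 1"])
  qed
  then show ?thesis using that by blast
qed

lemma subst_seq_in_block:
  assumes "block_start \<sigma> y k \<le> n" "n < block_start \<sigma> y (k + 1)"
  shows "subst_seq \<sigma> y n = \<sigma> (y k) ! nat (n - block_start \<sigma> y k)"
  using subst_seq_block[of "nat (n - block_start \<sigma> y k)" \<sigma> y k] assms
  by (simp add: block_start_step)

lemma block_start_shift:
  "block_start \<sigma> (\<lambda>j. z (k + j)) j = block_start \<sigma> z (k + j) - block_start \<sigma> z k"
proof (induction j rule: int_induct[where k = 0])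
  case base
  show ?case by simp
next
  case (step1 j)
  then show ?case
    using block_start_step[of \<sigma> z "k + j"] block_start_step[of \<sigma> "\<lambda>j. z (k + j)" j]
    by (simp add: add.assoc)
next
  case (step2 j)
  then show ?case
    using block_start_step[of \<sigma> z "k + (j - 1)"] block_start_step[of \<sigma> "\<lambda>j. z (k + j)" "j - 1"]
    by (simp add: algebra_simps)
qed

lemma subst_seq_shift:
  assumes "is_substitution \<sigma>"
  shows "subst_seq \<sigma> (\<lambda>j. z (k + j)) n = subst_seq \<sigma> z (n + block_start \<sigma> z k)"
proof -
  obtain l where l: "block_start \<sigma> (\<lambda>j. z (k + j)) l \<le> n" "n < block_start \<sigma> (\<lambda>j. z (k + j)) (l + 1)"
    using block_exists[OF assms] .
  then have "block_start \<sigma> z (k + l) \<le> n + block_start \<sigma> z k"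
    "n + block_start \<sigma> z k < block_start \<sigma> z (k + l + 1)"
    unfolding block_start_shift by (simp_all add: add.assoc)
  then show ?thesis
    using subst_seq_in_block[OF l] subst_seq_in_block[of \<sigma> z "k + l" "n + block_start \<sigma> z k"]
    unfolding block_start_shift by (simp add: algebra_simps)
qed

text \<open>Nonempty blocks make \<open>\<sigma>(y)\<close> grow at least as fast as \<open>y\<close>: the block covering \<open>n\<close> has an index
no larger than \<open>n\<close> in absolute value.\<close>

lemma subst_seq_local:
  assumes \<sigma>: "is_substitution \<sigma>" and agree: "\<And>j. \<bar>j\<bar> \<le> M \<Longrightarrow> y j = z j" and n: "\<bar>n\<bar> \<le> M"
  shows "subst_seq \<sigma> y n = subst_seq \<sigma> z n"
proof -
  obtain k where k: "block_start \<sigma> y k \<le> n" "n < block_start \<sigma> y (k + 1)"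
    using block_exists[OF \<sigma>] .
  have kM: "\<bar>k\<bar> \<le> M"
  proof (cases "0 \<le> k")
    case True
    then show ?thesis using block_start_ge[OF \<sigma> True, of y] k n by simp
  next
    case False
    then show ?thesis using block_start_ge[OF \<sigma>, of "k + 1" 0 y] k n by simp
  qed
  have "block_start \<sigma> y k = block_start \<sigma> z k"
    using kM agree unfolding block_start_def by (auto intro!: sum.cong)
  then show ?thesis
    using subst_seq_in_block[OF k] subst_seq_in_block[of \<sigma> z k n] k agree[OF kM]
    by (simp add: block_start_step)
qed

lemma occurs_subst:
  assumes "occurs z q u"
  shows "occurs (subst_seq \<sigma> z) (block_start \<sigma> z q) (subst_word \<sigma> u) \<and>
    block_start \<sigma> z (q + int (length u)) = block_start \<sigma> z q + int (length (subst_word \<sigma> u))"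
  using assms
proof (induction u arbitrary: q)
  case Nil
  then show ?case by (simp add: subst_word_def)
next
  case (Cons a u)
  have a: "z q = a" "occurs z (q + 1) u" using Cons.prems by (auto simp: occurs_Cons)
  have "occurs (subst_seq \<sigma> z) (block_start \<sigma> z q) (\<sigma> a)"
    unfolding occurs_def using subst_seq_block[of _ \<sigma> z q] a by simp
  then show ?case
    using Cons.IH[OF a(2)] a(1) block_start_step[of \<sigma> z q]
    by (simp add: subst_word_def occurs_append add.assoc)
qed

lemma occurs_left_shift: "occurs ((left_shift ^^ i) x) p w \<longleftrightarrow> occurs x (p + int i) w"
  unfolding left_shift_funpow occurs_def by (simp add: algebra_simps)

lemma track_image:
  assumes Q: "track W z Q"
  shows "track (subst_word \<sigma> ` W) ((left_shift ^^ i) (subst_seq \<sigma> z))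
    ((\<lambda>q. block_start \<sigma> z q - int i) ` Q)"
  unfolding track_def occurs_left_shift
proof (intro ballI conjI)
  fix p assume "p \<in> (\<lambda>q. block_start \<sigma> z q - int i) ` Q"
  then obtain q where q: "q \<in> Q" "p = block_start \<sigma> z q - int i" by blast
  obtain u where u: "u \<in> W" "occurs z q u" "q + int (length u) \<in> Q"
    using trackE_next[OF Q q(1)] .
  show "\<exists>v\<in>subst_word \<sigma> ` W. occurs (subst_seq \<sigma> z) (p + int i) v \<and>
      p + int (length v) \<in> (\<lambda>q. block_start \<sigma> z q - int i) ` Q"
  proof (intro bexI[of _ "subst_word \<sigma> u"] conjI)
    show "subst_word \<sigma> u \<in> subst_word \<sigma> ` W" using u(1) by simp
    show "occurs (subst_seq \<sigma> z) (p + int i) (subst_word \<sigma> u)"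
      using occurs_subst[OF u(2), of \<sigma>] q(2) by (simp add: algebra_simps)
    show "p + int (length (subst_word \<sigma> u)) \<in> (\<lambda>q. block_start \<sigma> z q - int i) ` Q"
      using occurs_subst[OF u(2), of \<sigma>] q(2)
      by (intro image_eqI[OF _ u(3)]) (simp add: algebra_simps)
  qed
  obtain v where v: "v \<in> W" "occurs z (q - int (length v)) v" "q - int (length v) \<in> Q"
    using trackE_prev[OF Q q(1)] .
  show "\<exists>v\<in>subst_word \<sigma> ` W. occurs (subst_seq \<sigma> z) (p - int (length v) + int i) v \<and>
      p - int (length v) \<in> (\<lambda>q. block_start \<sigma> z q - int i) ` Q"
  proof (intro bexI[of _ "subst_word \<sigma> v"] conjI)
    show "subst_word \<sigma> v \<in> subst_word \<sigma> ` W" using v(1) by simp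
    show "occurs (subst_seq \<sigma> z) (p - int (length (subst_word \<sigma> v)) + int i) (subst_word \<sigma> v)"
      using occurs_subst[OF v(2), of \<sigma>] q(2) by (simp add: algebra_simps)
    show "p - int (length (subst_word \<sigma> v)) \<in> (\<lambda>q. block_start \<sigma> z q - int i) ` Q"
      using occurs_subst[OF v(2), of \<sigma>] q(2)
      by (intro image_eqI[OF _ v(3)]) (simp add: algebra_simps)
  qed
qed

lemma track_refine:
  assumes Q: "track W y Q" "Q \<noteq> {}" and W: "[] \<notin> W" "W \<subseteq> star Y"
  obtains R where "track Y y R" "R \<noteq> {}"
proof -
  \<comment> \<open>\<open>r\<close> cuts the \<open>W\<close>-block at \<open>q\<close>, spelled over \<open>Y\<close>, into its parts \<open>us\<close> and \<open>vs\<close>.\<close>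
  define cut where "cut = (\<lambda>r q us vs. r = q + int (length (concat us)) \<and> q \<in> Q \<and>
    us \<in> lists Y \<and> vs \<in> lists Y \<and> occurs y q (concat us @ concat vs) \<and>
    concat us @ concat vs \<in> W \<and> q + int (length (concat us @ concat vs)) \<in> Q)"
  define R where "R = {r. \<exists>q us vs. cut r q us vs}"
  have after: "\<exists>vs. cut q q [] vs \<and> vs \<noteq> []" if q: "q \<in> Q" for q
  proof -
    obtain w where w: "w \<in> W" "occurs y q w" "q + int (length w) \<in> Q"
      using trackE_next[OF Q(1) q] .
    then obtain ws where "ws \<in> lists Y" "w = concat ws" using W(2) by blast
    then show ?thesis using w W(1) q unfolding cut_def by (intro exI[of _ ws]) auto
  qed
  have before: "\<exists>p us. cut q p us [] \<and> us \<noteq> []" if q: "q \<in> Q" for q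
  proof -
    obtain w where w: "w \<in> W" "occurs y (q - int (length w)) w" "q - int (length w) \<in> Q"
      using trackE_prev[OF Q(1) q] .
    then obtain ws where "ws \<in> lists Y" "w = concat ws" using W(2) by blast
    then show ?thesis using w W(1) q unfolding cut_def
      by (intro exI[of _ "q - int (length w)"] exI[of _ ws]) auto
  qed
  have "track Y y R"
    unfolding track_def
  proof (intro ballI conjI)
    fix r assume "r \<in> R"
    then obtain q0 us0 vs0 where c: "cut r q0 us0 vs0" unfolding R_def by blast
    obtain q us v vs where c1: "cut r q us (v # vs)"
    proof (cases vs0)
      case Nil
      then have "r \<in> Q" using c unfolding cut_def by simp
      then show ?thesis using after that by (metis neq_Nil_conv)
    qed (use c that in blast)
    then have "v \<in> Y" "occurs y r v" "cut (r + int (length v)) q (us @ [v]) vs"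
      unfolding cut_def by (auto simp: occurs_append algebra_simps)
    then show "\<exists>v\<in>Y. occurs y r v \<and> r + int (length v) \<in> R" unfolding R_def by blast
    obtain q us u vs where c2: "cut r q (us @ [u]) vs"
    proof (cases us0 rule: rev_cases)
      case Nil
      then have "r \<in> Q" using c unfolding cut_def by simp
      then show ?thesis using before that by (metis rev_exhaust)
    qed (use c that in blast)
    then have "u \<in> Y" "occurs y (r - int (length u)) u" "cut (r - int (length u)) q us (u # vs)"
      unfolding cut_def by (auto simp: occurs_append algebra_simps)
    then show "\<exists>v\<in>Y. occurs y (r - int (length v)) v \<and> r - int (length v) \<in> R"
      unfolding R_def by blast
  qed
  moreover have "R \<noteq> {}" using after Q(2) unfolding R_def by blast
  ultimately show ?thesis using that by blast
qed

section \<open>Desubstitution\<close>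

text \<open>Sequential compactness of \<open>B\<^sup>\<nat>\<close> for a finite set \<open>B\<close>: prefixes shared by infinitely many
members of the sequence are extended letter by letter.\<close>

lemma pointwise_cluster:
  fixes f :: "nat \<Rightarrow> nat \<Rightarrow> 'b::finite"
  shows "\<exists>g. \<forall>M. \<exists>N\<ge>M. \<forall>k<M. f N k = g k"
proof -
  define I where "I = (\<lambda>w. infinite {N. \<forall>k<length w. f N k = w ! k})"
  have ext: "\<exists>c. I (w @ [c])" if w: "I w" for w
  proof -
    let ?A = "{N. \<forall>k<length w. f N k = w ! k}"
    obtain N0 where "infinite {N \<in> ?A. f N (length w) = f N0 (length w)}"
      using pigeonhole_infinite[OF w[unfolded I_def] finite, of "\<lambda>N. f N (length w)"] by blast
    moreover have "{N \<in> ?A. f N (length w) = c} = {N. \<forall>k<length (w @ [c]). f N k = (w @ [c]) ! k}" for c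
      by (auto simp: nth_append less_Suc_eq)
    ultimately show ?thesis unfolding I_def by metis
  qed
  have "\<exists>ws. \<forall>n. (length (ws n) = n \<and> I (ws n)) \<and> (\<exists>c. ws (Suc n) = ws n @ [c])"
  proof (rule dependent_nat_choice)
    show "\<exists>w. length w = 0 \<and> I w" unfolding I_def by simp
    show "\<exists>v. (length v = Suc n \<and> I v) \<and> (\<exists>c. v = w @ [c])" if w: "length w = n \<and> I w" for w n
    proof -
      obtain c where "I (w @ [c])" using ext w by blast
      then show ?thesis using w by (intro exI[of _ "w @ [c]"]) simp
    qed
  qed
  then obtain ws where ws: "\<And>n. length (ws n) = n" "\<And>n. I (ws n)" "\<And>n. \<exists>c. ws (Suc n) = ws n @ [c]"
    by blast
  define g where "g = (\<lambda>k. ws (Suc k) ! k)"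
  have g: "k < n \<Longrightarrow> ws n ! k = g k" for k n
  proof (induction n)
    case (Suc n)
    obtain c where "ws (Suc n) = ws n @ [c]" using ws(3) by blast
    then show ?case using Suc ws(1)[of n] unfolding g_def by (cases "k = n") (auto simp: nth_append)
  qed simp
  have "\<exists>N\<ge>M. \<forall>k<M. f N k = g k" for M
    using ws(2)[of M] g[of _ M] unfolding I_def infinite_nat_iff_unbounded_le by (auto simp: ws(1))
  then show ?thesis by blast
qed

lemma two_sided_cluster:
  fixes f :: "nat \<Rightarrow> int \<Rightarrow> 'b::finite"
  obtains g where "\<And>M. \<exists>N\<ge>M. \<forall>j. \<bar>j\<bar> \<le> int M \<longrightarrow> f N j = g j"
proof -
  obtain h where h: "\<And>M. \<exists>N\<ge>M. \<forall>k<M. (f N (int k), f N (- int k)) = h k"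
    using pointwise_cluster[of "\<lambda>N k. (f N (int k), f N (- int k))"] by blast
  define g where "g = (\<lambda>j. if 0 \<le> j then fst (h (nat j)) else snd (h (nat (- j))))"
  have "\<exists>N\<ge>M. \<forall>j. \<bar>j\<bar> \<le> int M \<longrightarrow> f N j = g j" for M
  proof -
    obtain N where N: "N \<ge> Suc M" "\<And>k. k < Suc M \<Longrightarrow> (f N (int k), f N (- int k)) = h k"
      using h[of "Suc M"] by blast
    have "f N j = g j" if "\<bar>j\<bar> \<le> int M" for j
    proof (cases "0 \<le> j")
      case True
      then show ?thesis using N(2)[of "nat j"] that unfolding g_def by (auto simp: prod_eq_iff)
    next
      case False
      then show ?thesis using N(2)[of "nat (- j)"] that unfolding g_def by (auto simp: prod_eq_iff)
    qed
    then show ?thesis using N(1) by (intro exI[of _ N]) auto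
  qed
  then show ?thesis using that by blast
qed

text \<open>The centre of a long window of \<open>x\<close>, seen inside \<open>\<sigma>(w)\<close>, lies in the block of some letter of \<open>w\<close>.
A window of length proportional to \<open>N\<close> guarantees \<open>N\<close> further letters of \<open>w\<close> on both sides.
The condition on \<open>\<sigma>(y)\<close> is phrased by coordinates of \<open>\<sigma>(y)\<close> so that it depends on
\<open>y[-N, N]\<close> only.\<close>

lemma approximate_desubstitution:
  fixes \<sigma> :: "'a::finite \<Rightarrow> 'a list"
  assumes \<sigma>: "is_substitution \<sigma>" and x: "x \<in> subst_shift \<sigma>"
  shows "\<exists>y i. i < length (\<sigma> (y 0)) \<and> map y [- int N..int N] \<in> subst_language \<sigma> \<and>
    (\<forall>e. \<bar>e + int i\<bar> \<le> int N \<longrightarrow> x e = subst_seq \<sigma> y (e + int i))"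
proof -
  define K where "K = Max (range (\<lambda>a. length (\<sigma> a)))"
  have K: "length (\<sigma> a) \<le> K" for a unfolding K_def by simp
  have "0 < length (\<sigma> undefined)" using \<sigma> unfolding is_substitution_def by simp
  then have K1: "K \<ge> 1" using K[of undefined] by linarith
  define n where "n = (N + 2) * K"
  have n: "int n = (int N + 2) * int K" "N + 2 * K \<le> n"
    using K1 unfolding n_def by (simp_all add: algebra_simps)
  have "map x [- int n..int n] \<in> subst_language \<sigma>" using x unfolding subst_shift_def by blast
  then obtain a m where m: "m \<ge> 1" "sublist (map x [- int n..int n]) ((subst_word \<sigma> ^^ m) [a])"
    unfolding subst_language_def by blast
  \<comment> \<open>The language starts with the first powers of \<open>\<sigma>\<close>; the preimage \<open>w\<close> must still be one of them.\<close>
  have "m \<noteq> 1"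
  proof
    assume "m = 1"
    then have "length (map x [- int n..int n]) \<le> length (\<sigma> a)"
      using sublist_length_le[OF m(2)] by (simp add: subst_word_def)
    then show False using K[of a] K1 n(2) by simp
  qed
  then obtain m' where m': "m = Suc m'" "m' \<ge> 1" using m(1) by (cases m) auto
  define w where "w = (subst_word \<sigma> ^^ m') [a]"
  obtain pre post where split: "subst_word \<sigma> w = pre @ map x [- int n..int n] @ post"
    using m(2) m' unfolding w_def sublist_def by auto
  \<comment> \<open>The word \<open>w\<close> at coordinate \<open>0\<close> of a sequence whose other values are arbitrary.\<close>
  define z where "z = (\<lambda>j. w ! nat j)"
  have z: "occurs z 0 w" unfolding occurs_def z_def by simp
  \<comment> \<open>The coordinate of the centre of the window in \<open>\<sigma>(z)\<close>.\<close>
  define c where "c = int (length pre) + int n"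
  have total: "block_start \<sigma> z (int (length w)) = int (length (subst_word \<sigma> w))"
    using occurs_subst[OF z, of \<sigma>] by simp
  have "occurs (subst_seq \<sigma> z) 0 (pre @ map x [- int n..int n] @ post)"
    using occurs_subst[OF z, of \<sigma>] split by simp
  then have "occurs (subst_seq \<sigma> z) (int (length pre)) (map x [- int n..int n])"
    by (simp add: occurs_append)
  then have block: "subst_seq \<sigma> z (int (length pre) + int t) = x (int t - int n)" if "t \<le> 2 * n" for t
    using that unfolding occurs_def by simp
  have xz: "x e = subst_seq \<sigma> z (c + e)" if "\<bar>e\<bar> \<le> int n" for e
  proof -
    have "int (nat (e + int n)) = e + int n" "nat (e + int n) \<le> 2 * n" using that by linarith+
    then show ?thesis using block[of "nat (e + int n)"] unfolding c_def by (simp add: ac_simps)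
  qed
  obtain k where k: "block_start \<sigma> z k \<le> c" "c < block_start \<sigma> z (k + 1)"
    using block_exists[OF \<sigma>] .
  have le: "block_start \<sigma> z t \<le> block_start \<sigma> z s + (t - s) * int K" if "s \<le> t" for s t
    using block_start_le[of \<sigma> "int K"] K that by simp
  have "int N \<le> k"
  proof (rule ccontr)
    assume "\<not> int N \<le> k"
    then have "block_start \<sigma> z (k + 1) \<le> block_start \<sigma> z (int N)" by (intro block_start_mono) simp
    also have "\<dots> \<le> int N * int K" using le[of 0 "int N"] by simp
    finally show False using k(2) n(1) unfolding c_def by (simp add: algebra_simps)
  qed
  moreover have "k + int N < int (length w)"
  proof (rule ccontr)
    assume "\<not> k + int N < int (length w)"
    then have "block_start \<sigma> z (int (length w)) \<le> block_start \<sigma> z (k + int N)"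
      by (intro block_start_mono) simp
    also have "\<dots> \<le> c + int N * int K" using le[of k "k + int N"] k(1) by simp
    finally show False using total split n(1) K1 unfolding c_def by (simp add: algebra_simps)
  qed
  ultimately have kN: "int N \<le> k" "k + int N < int (length w)" by blast+
  \<comment> \<open>Recentring at the letter whose block covers \<open>c\<close>.\<close>
  define y where "y = (\<lambda>j. z (k + j))"
  define i where "i = nat (c - block_start \<sigma> z k)"
  have i: "int i = c - block_start \<sigma> z k" "i < length (\<sigma> (z k))"
    using k unfolding i_def block_start_step by auto
  have "[0..int (length w) - 1] =
      [0..k - int N - 1] @ [k - int N..k + int N] @ [k + int N + 1..int (length w) - 1]"
    using upto_split1[of 0 "k - int N" "int (length w) - 1"]
      upto_split2[of "k - int N" "k + int N" "int (length w) - 1"] kN by simp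
  moreover have "map z [0..int (length w) - 1] = w"
    unfolding z_def by (intro nth_equalityI) auto
  moreover have "map y [- int N..int N] = map z [k - int N..k + int N]"
    unfolding y_def by (intro nth_equalityI) (auto simp: algebra_simps)
  ultimately have "sublist (map y [- int N..int N]) w"
    unfolding sublist_def by (metis map_append)
  then have "map y [- int N..int N] \<in> subst_language \<sigma>"
    using m'(2) unfolding w_def subst_language_def by blast
  moreover have "x e = subst_seq \<sigma> y (e + int i)" if "\<bar>e + int i\<bar> \<le> int N" for e
  proof -
    have "\<bar>e\<bar> \<le> int n" using that i(2) K[of "z k"] n(2) by linarith
    then show ?thesis using xz[of e] i(1) unfolding y_def subst_seq_shift[OF \<sigma>]
      by (simp add: algebra_simps)
  qed
  moreover have "i < length (\<sigma> (y 0))" using i(2) unfolding y_def by simp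
  ultimately show ?thesis by blast
qed

lemma desubstitution:
  fixes \<sigma> :: "'a::finite \<Rightarrow> 'a list"
  assumes \<sigma>: "is_substitution \<sigma>" and x: "x \<in> subst_shift \<sigma>"
  obtains y i where "y \<in> subst_shift \<sigma>" "i < length (\<sigma> (y 0))"
    "x = (left_shift ^^ i) (subst_seq \<sigma> y)"
proof -
  define good where "good = (\<lambda>N y i. i < length (\<sigma> (y 0)) \<and>
    map y [- int N..int N] \<in> subst_language \<sigma> \<and>
    (\<forall>e. \<bar>e + int i\<bar> \<le> int N \<longrightarrow> x e = subst_seq \<sigma> y (e + int i)))"
  have "\<forall>N. \<exists>y i. good N y i"
    using approximate_desubstitution[OF \<sigma> x] unfolding good_def by blast
  then obtain f g where fg: "\<And>N. good N (f N) (g N)" by metis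
  obtain y where y: "\<And>M. \<exists>N\<ge>M. \<forall>j. \<bar>j\<bar> \<le> int M \<longrightarrow> f N j = y j"
    using two_sided_cluster[of f] by blast
  have sub: "map h [- int M..int M] \<in> subst_language \<sigma>"
    if "map h [- int N..int N] \<in> subst_language \<sigma>" "M \<le> N" for M N h
  proof -
    have "[- int N..int N] = [- int N..- int M - 1] @ [- int M..int M] @ [int M + 1..int N]"
      using upto_split1[of "- int N" "- int M" "int N"] upto_split2[of "- int M" "int M" "int N"]
        that(2) by simp
    then have "sublist (map h [- int M..int M]) (map h [- int N..int N])"
      unfolding sublist_def by (metis map_append)
    then show ?thesis using that(1) sublist_order.order_trans unfolding subst_language_def by blast
  qed
  have mono: "good M h i" if "good N h i" "M \<le> N" for M N h i
    using that sub unfolding good_def by auto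
  have ex: "\<exists>i. good M y i" for M
  proof -
    obtain N where N: "N \<ge> M" "\<And>j. \<bar>j\<bar> \<le> int M \<Longrightarrow> f N j = y j" using y by blast
    have "good M (f N) (g N)" using mono[OF fg N(1)] .
    moreover have "map (f N) [- int M..int M] = map y [- int M..int M]" using N(2) by auto
    ultimately have "good M y (g N)"
      unfolding good_def using N(2)[of 0] subst_seq_local[OF \<sigma>, of "int M" "f N" y] N(2) by auto
    then show ?thesis by blast
  qed
  \<comment> \<open>The offset is bounded by the length of the block of \<open>y 0\<close>, so one offset serves all \<open>M\<close>.\<close>
  have "\<exists>i. \<forall>M. good M y i"
  proof (rule ccontr)
    assume "\<not> ?thesis"
    then obtain b where b: "\<And>i. \<not> good (b i) y i" by metis
    obtain i where i: "good (Max (b ` {..<length (\<sigma> (y 0))})) y i" using ex by blast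
    then have "i < length (\<sigma> (y 0))" unfolding good_def by blast
    then have "b i \<le> Max (b ` {..<length (\<sigma> (y 0))})" by simp
    then show False using mono[OF i] b by blast
  qed
  then obtain i where i: "\<And>M. good M y i" by blast
  have "y \<in> subst_shift \<sigma>" "i < length (\<sigma> (y 0))"
    using i unfolding good_def subst_shift_def by blast+
  moreover have "x e = subst_seq \<sigma> y (e + int i)" for e
    using i[of "nat \<bar>e + int i\<bar>"] unfolding good_def by simp
  then have "x = (left_shift ^^ i) (subst_seq \<sigma> y)" unfolding left_shift_funpow by blast
  ultimately show ?thesis using that by blast
qed

section \<open>Recognizability\<close>

lemma power_track:
  fixes \<sigma> :: "'a::finite \<Rightarrow> 'a list"
  assumes \<sigma>: "is_substitution \<sigma>" and "y \<in> subst_shift \<sigma>"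
  shows "\<exists>P. track (range (\<lambda>a. (subst_word \<sigma> ^^ n) [a])) y P \<and> P \<noteq> {}"
  using assms(2)
proof (induction n arbitrary: y)
  case 0
  have "track (range (\<lambda>a. [a])) y UNIV" unfolding track_def by (auto simp: occurs_Cons)
  then show ?case by auto
next
  case (Suc n)
  obtain z i where z: "z \<in> subst_shift \<sigma>" "y = (left_shift ^^ i) (subst_seq \<sigma> z)"
    using desubstitution[OF \<sigma> Suc.prems] by metis
  obtain P where P: "track (range (\<lambda>a. (subst_word \<sigma> ^^ n) [a])) z P" "P \<noteq> {}"
    using Suc.IH[OF z(1)] by blast
  have "subst_word \<sigma> ` range (\<lambda>a. (subst_word \<sigma> ^^ n) [a]) =
      range (\<lambda>a. (subst_word \<sigma> ^^ Suc n) [a])"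
    by (simp add: image_image)
  then have "track (range (\<lambda>a. (subst_word \<sigma> ^^ Suc n) [a])) y
      ((\<lambda>q. block_start \<sigma> z q - int i) ` P)"
    using track_image[OF P(1), of \<sigma> i] z(2) by simp
  then show ?case using P(2) by blast
qed

lemma subst_word_star: "subst_word \<sigma> ` star Y \<subseteq> star (subst_word \<sigma> ` Y)"
proof (intro image_subsetI)
  fix w assume "w \<in> star Y"
  then obtain us where us: "us \<in> lists Y" "w = concat us" by blast
  have "subst_word \<sigma> w = concat (map (subst_word \<sigma>) us)"
    unfolding us(2) subst_word_def by (induction us) auto
  moreover have "map (subst_word \<sigma>) us \<in> lists (subst_word \<sigma> ` Y)" using us(1) by auto
  ultimately show "subst_word \<sigma> w \<in> star (subst_word \<sigma> ` Y)" by blast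
qed

lemma subst_word_eq_Nil: "is_substitution \<sigma> \<Longrightarrow> subst_word \<sigma> w = [] \<longleftrightarrow> w = []"
  unfolding subst_word_def is_substitution_def by (cases w) auto

lemma subst_power_eq_Nil:
  "is_substitution \<sigma> \<Longrightarrow> (subst_word \<sigma> ^^ n) w = [] \<longleftrightarrow> w = []"
  by (induction n) (auto simp: subst_word_eq_Nil)

text \<open>If \<open>Y\<close> generates level \<open>n\<close>, then \<open>\<sigma>(Y)\<close> generates level \<open>n + 1\<close>, and so does any set that
generates \<open>\<sigma>(Y)\<close>. With \<open>|Y|\<close> minimal over all levels, none of these can have fewer elements.\<close>

lemma elementary_level:
  fixes \<sigma> :: "'a::finite \<Rightarrow> 'a list"
  assumes \<sigma>: "is_substitution \<sigma>"
  obtains n Y where "range (\<lambda>a. (subst_word \<sigma> ^^ n) [a]) \<subseteq> star Y"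
    "elementary (subst_word \<sigma> ` Y)" "inj_on (subst_word \<sigma>) Y" "[] \<notin> Y"
proof -
  define S where "S = (\<lambda>n. range (\<lambda>a. (subst_word \<sigma> ^^ n) [a]))"
  define ok where "ok = (\<lambda>Y. finite Y \<and> [] \<notin> Y \<and> (\<exists>n. S n \<subseteq> star Y))"
  have "ok (S 0)" using star_base[of _ "S 0"] unfolding ok_def
    by (intro conjI exI[of _ 0] subsetI) (auto simp: S_def)
  then obtain Y where Y: "ok Y" and min: "\<And>Z. ok Z \<Longrightarrow> card Y \<le> card Z"
    using ex_has_least_nat[of ok _ card] by metis
  obtain n where n: "S n \<subseteq> star Y" using Y unfolding ok_def by blast
  let ?V = "subst_word \<sigma> ` Y"
  have "S (Suc n) = subst_word \<sigma> ` S n" unfolding S_def by (simp add: image_image)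
  then have "S (Suc n) \<subseteq> subst_word \<sigma> ` star Y" using n by (simp add: image_mono)
  then have V: "S (Suc n) \<subseteq> star ?V" using subst_word_star by (rule subset_trans)
  have finV: "finite ?V" using Y unfolding ok_def by simp
  have neV: "[] \<notin> ?V" using Y subst_word_eq_Nil[OF \<sigma>] unfolding ok_def by (metis imageE)
  note fin = finV neV
  have "card Y \<le> card ?V" using min fin V unfolding ok_def by blast
  moreover have "card ?V \<le> card Y" using Y card_image_le unfolding ok_def by blast
  ultimately have eq: "card ?V = card Y" by simp
  have "elementary ?V"
    unfolding elementary_def
  proof (intro conjI allI impI)
    fix Z assume "finite Z" "[] \<notin> Z" "?V \<subseteq> star Z"
    then have "ok Z" using star_trans[OF V] unfolding ok_def by blast
    then show "card ?V \<le> card Z" using min eq by simp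
  qed (use fin in auto)
  moreover have "inj_on (subst_word \<sigma>) Y" using eq Y eq_card_imp_inj_on unfolding ok_def by blast
  ultimately show ?thesis using that n Y unfolding S_def ok_def by blast
qed

lemma aperiodic_no_translation:
  assumes "aperiodic_subst \<sigma>" "x \<in> subst_shift \<sigma>"
  shows "\<not> (\<exists>D>0. \<forall>j. x (j + D) = x j)"
proof
  assume "\<exists>D>0. \<forall>j. x (j + D) = x j"
  then obtain D where D: "D > 0" "\<And>j. x (j + D) = x j" by blast
  have "(left_shift ^^ nat D) x = x" unfolding left_shift_funpow using D by simp
  moreover have "nat D > 0" using D(1) by simp
  ultimately show False using assms unfolding aperiodic_subst_def by blast
qed

text \<open>The cuts of the \<open>Y\<close>-factorizations of \<open>y\<close> and \<open>y'\<close> have the same images in \<open>x\<close>. Fixing one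
common image aligns \<open>y\<close> with a translate of \<open>y'\<close>, and comparing blocks of \<open>x\<close> extends the
alignment over both sequences. The offsets \<open>i\<close> and \<open>i'\<close> place coordinate \<open>0\<close> of \<open>x\<close> in the block
of \<open>y 0\<close> and of \<open>y' 0\<close>, so the translation is trivial.\<close>

lemma representation_unique:
  fixes \<sigma> :: "'a::finite \<Rightarrow> 'a list"
  assumes \<sigma>: "is_substitution \<sigma>" and aper: "aperiodic_subst \<sigma>" and x: "x \<in> subst_shift \<sigma>"
    and y: "y \<in> subst_shift \<sigma>" "i < length (\<sigma> (y 0))" "x = (left_shift ^^ i) (subst_seq \<sigma> y)"
    and y': "y' \<in> subst_shift \<sigma>" "i' < length (\<sigma> (y' 0))" "x = (left_shift ^^ i') (subst_seq \<sigma> y')"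
  shows "y = y' \<and> i = i'"
proof -
  obtain n Y where Y: "range (\<lambda>a. (subst_word \<sigma> ^^ n) [a]) \<subseteq> star Y"
    "elementary (subst_word \<sigma> ` Y)" "inj_on (subst_word \<sigma>) Y" "[] \<notin> Y"
    using elementary_level[OF \<sigma>] .
  have ne: "[] \<notin> range (\<lambda>a. (subst_word \<sigma> ^^ n) [a])" 
  proof
    assume "[] \<in> range (\<lambda>a. (subst_word \<sigma> ^^ n) [a])"
    then obtain a where "[] = (subst_word \<sigma> ^^ n) [a]" by (rule rangeE)
    then show False using subst_power_eq_Nil[OF \<sigma>, of n "[a]"] by simp
  qed
  have lift: "\<exists>Q. track Y h Q \<and> Q \<noteq> {}" if h: "h \<in> subst_shift \<sigma>" for h
  proof -
    obtain P where P: "track (range (\<lambda>a. (subst_word \<sigma> ^^ n) [a])) h P" "P \<noteq> {}"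
      using power_track[OF \<sigma> h] by blast
    obtain Q where "track Y h Q" "Q \<noteq> {}" using track_refine[OF P ne Y(1)] .
    then show ?thesis by blast
  qed
  obtain Q where Q: "track Y y Q" "Q \<noteq> {}" using lift[OF y(1)] by blast
  obtain Q' where Q': "track Y y' Q'" "Q' \<noteq> {}" using lift[OF y'(1)] by blast
  let ?V = "subst_word \<sigma> ` Y"
  define b where "b = (\<lambda>q. block_start \<sigma> y q - int i)"
  define b' where "b' = (\<lambda>q. block_start \<sigma> y' q - int i')"
  have P: "track ?V x (b ` Q)" using track_image[OF Q(1), of \<sigma> i] y(3) unfolding b_def by simp
  have P': "track ?V x (b' ` Q')" using track_image[OF Q'(1), of \<sigma> i'] y'(3) unfolding b'_def by simp
  have same: "b ` Q = b' ` Q'"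
    using track_unique[OF Y(2) P _ P' _ aperiodic_no_translation[OF aper x]] Q(2) Q'(2) by blast
  have b: "occurs x (b q) (subst_word \<sigma> u)" "b (q + int (length u)) = b q + int (length (subst_word \<sigma> u))"
    if "occurs y q u" for q u
    using occurs_subst[OF that, of \<sigma>] occurs_left_shift[of i "subst_seq \<sigma> y"]
    unfolding y(3) b_def by simp_all
  have b': "occurs x (b' q) (subst_word \<sigma> u)" "b' (q + int (length u)) = b' q + int (length (subst_word \<sigma> u))"
    if "occurs y' q u" for q u
    using occurs_subst[OF that, of \<sigma>] occurs_left_shift[of i' "subst_seq \<sigma> y'"]
    unfolding y'(3) b'_def by simp_all
  obtain q0 where "q0 \<in> Q" using Q(2) by blast
  then obtain q1 where "q1 \<in> Q'" "b q0 = b' q1" using same by blast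
  \<comment> \<open>The presumed translation from \<open>y\<close> to \<open>y'\<close>, and the cuts of \<open>y\<close> at which it is correct.\<close>
  define E where "E = q1 - q0"
  define G where "G = {q \<in> Q. q + E \<in> Q' \<and> b q = b' (q + E)}"
  have q0: "q0 \<in> G" using \<open>q0 \<in> Q\<close> \<open>q1 \<in> Q'\<close> \<open>b q0 = b' q1\<close> unfolding G_def E_def by simp
  have forward: "occurs y' (g + E) u \<and> g + int (length u) \<in> G"
    if g: "g \<in> G" and u: "u \<in> Y" "occurs y g u" "g + int (length u) \<in> Q" for g u
  proof -
    have g': "g \<in> Q" "g + E \<in> Q'" "b g = b' (g + E)" using g unfolding G_def by auto
    obtain v where v: "v \<in> Y" "occurs y' (g + E) v" "g + E + int (length v) \<in> Q'"
      using trackE_next[OF Q'(1) g'(2)] .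
    have "subst_word \<sigma> u = subst_word \<sigma> v"
      using b[OF u(2)] b'[OF v(2)] u v g'(3) imageI[OF u(3), of b] imageI[OF v(3), of b']
      by (intro next_block_unique[OF Y(2) P P', where p = "b g"]) auto
    then have "u = v" using Y(3) u(1) v(1) by (auto dest: inj_onD)
    then show ?thesis
      using v u(3) b(2)[OF u(2)] b'(2)[OF v(2)] g'(3) unfolding G_def by (simp add: algebra_simps)
  qed
  have backward: "g - int (length u) \<in> G"
    if g: "g \<in> G" and u: "u \<in> Y" "occurs y (g - int (length u)) u" "g - int (length u) \<in> Q" for g u
  proof -
    have g': "g \<in> Q" "g + E \<in> Q'" "b g = b' (g + E)" using g unfolding G_def by auto
    obtain v where v: "v \<in> Y" "occurs y' (g + E - int (length v)) v" "g + E - int (length v) \<in> Q'"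
      using trackE_prev[OF Q'(1) g'(2)] .
    have bu: "b (g - int (length u)) = b g - int (length (subst_word \<sigma> u))"
      using b(2)[OF u(2)] by simp
    have bv: "b' (g + E - int (length v)) = b g - int (length (subst_word \<sigma> v))"
      using b'(2)[OF v(2)] g'(3) by simp
    have "subst_word \<sigma> u = subst_word \<sigma> v"
      using b(1)[OF u(2)] b'(1)[OF v(2)] u(1) v(1) imageI[OF u(3), of b] imageI[OF v(3), of b']
      unfolding bu bv
      by (intro previous_block_unique[OF Y(2) P P', where p = "b g"]) auto
    then have "u = v" using Y(3) u(1) v(1) by (auto dest: inj_onD)
    then show ?thesis using u(3) v(3) bu bv unfolding G_def by (simp add: algebra_simps)
  qed
  have G: "track Y y G"
    unfolding track_def
  proof (intro ballI conjI)
    fix g assume g: "g \<in> G"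
    then have "g \<in> Q" unfolding G_def by simp
    show "\<exists>u\<in>Y. occurs y g u \<and> g + int (length u) \<in> G"
      using trackE_next[OF Q(1) \<open>g \<in> Q\<close>] forward[OF g] by metis
    show "\<exists>u\<in>Y. occurs y (g - int (length u)) u \<and> g - int (length u) \<in> G"
      using trackE_prev[OF Q(1) \<open>g \<in> Q\<close>] backward[OF g] by metis
  qed
  have yy: "y j = y' (j + E)" for j
  proof -
    obtain g u where u: "g \<in> G" "u \<in> Y" "occurs y g u" "g + int (length u) \<in> G"
      "g \<le> j" "j < g + int (length u)"
      using track_covers[OF G Y(4)] q0 by (metis empty_iff)
    have "g + int (length u) \<in> Q" using u(4) unfolding G_def by simp
    then have "occurs y' (g + E) u" using forward[OF u(1,2,3)] by blast
    moreover have "nat (j - g) < length u" using u(5,6) by linarith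
    ultimately have "y (g + int (nat (j - g))) = y' (g + E + int (nat (j - g)))"
      using u(3) unfolding occurs_def by metis
    moreover have "g + int (nat (j - g)) = j" "g + E + int (nat (j - g)) = j + E"
      using u(5) by simp_all
    ultimately show ?thesis by metis
  qed
  have bb: "b j = b' (j + E)" for j
  proof (induction j rule: int_induct[where k = q0])
    case base
    show ?case using q0 unfolding G_def by simp
  next
    case (step1 j)
    then show ?case
      using block_start_step[of \<sigma> y j] block_start_step[of \<sigma> y' "j + E"] yy[of j]
      unfolding b_def b'_def by (simp add: algebra_simps)
  next
    case (step2 j)
    then show ?case
      using block_start_step[of \<sigma> y "j - 1"] block_start_step[of \<sigma> y' "j - 1 + E"] yy[of "j - 1"]
      unfolding b_def b'_def by (simp add: algebra_simps)
  qed
  have zero: "b 0 \<le> 0" "0 < b 1" "b' 0 \<le> 0" "0 < b' 1"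
    using y(2) y'(2) block_start_step[of \<sigma> y 0] block_start_step[of \<sigma> y' 0]
    unfolding b_def b'_def by simp_all
  have mono: "b' k \<le> b' l" if "k \<le> l" for k l
    using block_start_mono[OF that, of \<sigma> y'] unfolding b'_def by simp
  \<comment> \<open>Only one block of \<open>y'\<close> can cover coordinate \<open>0\<close> of \<open>x\<close>.\<close>
  have "E = 0"
  proof (rule ccontr)
    assume "E \<noteq> 0"
    then consider "E + 1 \<le> 0" | "1 \<le> E" by linarith
    then show False
      using bb[of 0] bb[of 1] mono[of "E + 1" 0] mono[of 1 E] zero by cases (auto simp: add.commute)
  qed
  then have "y = y'" using yy by auto
  moreover have "i = i'" using bb[of 0] \<open>E = 0\<close> unfolding b_def b'_def by simp
  ultimately show ?thesis by simp
qed

theorem theorem5p17: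
  fixes \<sigma> :: "'a::finite \<Rightarrow> 'a list"
  assumes "is_substitution \<sigma>"
    and "aperiodic_subst \<sigma>"
    and "uncountable (subst_shift \<sigma>)"
  shows "recognizable \<sigma>"
  unfolding recognizable_def
proof
  fix x assume x: "x \<in> subst_shift \<sigma>"
  obtain y i where "y \<in> subst_shift \<sigma>" "i < length (\<sigma> (y 0))" "x = (left_shift ^^ i) (subst_seq \<sigma> y)"
    using desubstitution[OF assms(1) x] .
  then show "\<exists>!(y, i). y \<in> subst_shift \<sigma> \<and> i < length (\<sigma> (y 0)) \<and>
      x = (left_shift ^^ i) (subst_seq \<sigma> y)"
    using representation_unique[OF assms(1,2) x] by (intro ex1I[of _ "(y, i)"]) auto
qed

end
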